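(* Let $(d_n)_{n\ge 1}$ be a sequence of nonnegative integers. Suppose that for every $k\in\mathbb N=\{1,2,\dots\}$ there exists a word system $(Y^{(k)}_n)_{n\in\mathbb N_0}$ (over some alphabet) with $\#Y^{(k)}_i=d_i$ for $i=1,\dots,k$. Then there exists a word system $(X_n)_{n\in\mathbb N_0}$ (over some alphabet) with $\#X_i=d_i$ for all $i\ge 1$.
   Context: An alphabet is a set $A$. $A^n$ is the set of words of length $n$ over $A$ ($n$-tuples of elements of $A$), $A^0=\{\Lambda\}$ with $\Lambda=()$ the empty word, and $A^*=\bigcup_{n\in\mathbb N_0}A^n$ is a monoid under concatenation. A word $y$ is a subword of $w$ if $w=xyz$ for some $x,z\in A^*$. A word system over $A$ is a family $(X_n)_{n\in\mathbb N_0}$ of subsets $X_n\subset A^n$ with $X_0=A^0$ that is closed under building subwords: whenever $w\in\bigcup_n X_n$ and $y\in A^k$ is a subword of $w$, then $y\in X_k$. *)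

theory Defs
  imports Main "HOL-Library.Sublist"
begin

definition words :: "'a set \<Rightarrow> nat \<Rightarrow> 'a list set" where
  "words A n = {w \<in> lists A. length w = n}"

text \<open>Subwords are contiguous factors, i.e. \<^const>\<open>sublist\<close> (not \<^const>\<open>subseq\<close>). For
  \<open>w = x @ y @ z\<close> in \<open>lists A\<close> the words \<open>x\<close> and \<open>z\<close> lie in \<open>lists A\<close> automatically.\<close>

definition word_system :: "'a set \<Rightarrow> (nat \<Rightarrow> 'a list set) \<Rightarrow> bool" where
  "word_system A X \<longleftrightarrow>
     (\<forall>n. X n \<subseteq> words A n) \<and>
     X 0 = words A 0 \<and>
     (\<forall>w \<in> (\<Union>n. X n). \<forall>k. \<forall>y \<in> words A k. sublist y w \<longrightarrow> y \<in> X k)"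

end

theory Submission imports Defs begin

text \<open>The letters of a word system with \<open>d 1\<close> words of length one can be renamed into a fixed
  alphabet \<open>B\<close> of size \<open>d 1\<close>. Over the finite alphabet \<open>B\<close> there are only finitely many candidates
  for the set of words of each length, so a compactness argument yields a sequence \<open>X\<close> each of
  whose initial segments is shared with infinitely many of the given systems. Both closure under
  subwords and the cardinalities only involve finitely many lengths at a time, and are inherited.\<close>

text \<open>Diagonal argument: infinite index sets \<open>K n\<close> are shrunk one coordinate at a
  time, the pigeonhole principle keeping infinitely many indices on which coordinate
  \<open>n\<close> is constant. That constant becomes \<open>g n\<close>.\<close>

lemma infinitely_many_agree_with_limit:
  fixes f :: "nat \<Rightarrow> nat \<Rightarrow> 'b"
  assumes "\<And>i. finite (range (\<lambda>k. f k i))"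
  shows "\<exists>g. \<forall>n. infinite {k. \<forall>i<n. f k i = g i}"
proof -
  have "\<exists>K. \<forall>n. infinite (K n) \<and> K (Suc n) \<subseteq> K n \<and> (\<exists>v. \<forall>k\<in>K (Suc n). f k n = v)"
  proof (rule dependent_nat_choice)
    show "\<exists>K :: nat set. infinite K" by auto
  next
    fix K :: "nat set" and n assume inf: "infinite K"
    have "finite ((\<lambda>k. f k n) ` K)"
      using assms[of n] by (rule finite_subset[rotated]) auto
    from pigeonhole_infinite[OF inf this] obtain a where "infinite {k\<in>K. f k n = f a n}" by blast
    then show "\<exists>K'. infinite K' \<and> K' \<subseteq> K \<and> (\<exists>v. \<forall>k\<in>K'. f k n = v)"
      by (intro exI[of _ "{k\<in>K. f k n = f a n}"]) auto
  qed
  then obtain K where inf: "\<And>n. infinite (K n)" and dec: "\<And>n. K (Suc n) \<subseteq> K n"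
    and "\<forall>n. \<exists>v. \<forall>k\<in>K (Suc n). f k n = v" by blast
  then obtain g where g: "\<And>n k. k \<in> K (Suc n) \<Longrightarrow> f k n = g n" by metis
  have "K n \<subseteq> {k. \<forall>i<n. f k i = g i}" for n
  proof safe
    fix k i assume "k \<in> K n" "i < n"
    then have "k \<in> K (Suc i)"
      using lift_Suc_antimono_le[of K "Suc i" n] dec by auto
    then show "f k i = g i" by (rule g)
  qed
  then show ?thesis using inf by (metis finite_subset)
qed

lemma finite_words: "finite B \<Longrightarrow> finite (words B n)"
  unfolding words_def using finite_lists_length_eq[of B n] by (simp add: lists_eq_set)

lemma word_system_subset: "word_system A Y \<Longrightarrow> Y n \<subseteq> words A n"
  by (simp add: word_system_def)

lemma word_system_0: "word_system A Y \<Longrightarrow> Y 0 = {[]}"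
  by (auto simp: word_system_def words_def)

lemma word_system_sublist:
  assumes "word_system A Y" "w \<in> Y n" "sublist y w"
  shows "y \<in> Y (length y)"
proof -
  have "set w \<subseteq> A" using word_system_subset[OF assms(1), of n] assms(2) by (auto simp: words_def)
  then have "y \<in> words A (length y)"
    using set_mono_sublist[OF assms(3)] by (auto simp: words_def)
  then show ?thesis using assms unfolding word_system_def by blast
qed

lemma word_systemI:
  assumes "\<And>n. X n \<subseteq> words A n" "X 0 = {[]}"
    and "\<And>n w y. w \<in> X n \<Longrightarrow> sublist y w \<Longrightarrow> y \<in> X (length y)"
  shows "word_system A X"
proof -
  have "y \<in> X k" if "w \<in> X n" "y \<in> words A k" "sublist y w" for n w k y
    using assms(3)[OF that(1,3)] that(2) by (simp add: words_def)
  moreover have "X 0 = words A 0" using assms(2) by (auto simp: words_def)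
  ultimately show ?thesis using assms(1) unfolding word_system_def by blast
qed

text \<open>Every letter of a word in \<open>Y n\<close> is itself a subword of length one, so all
  words live over the letters counted by \<open>Y 1\<close>. Hence injectivity of \<open>h\<close>
  on these letters suffices, and a subword of \<open>map h v\<close> is the image of a subword of
  \<open>v\<close>.\<close>

lemma word_system_rename:
  assumes Y: "word_system A Y" and h: "bij_betw h {a. [a] \<in> Y 1} B"
  shows "word_system B (\<lambda>n. map h ` Y n)" and "card (map h ` Y n) = card (Y n)"
proof -
  define L where "L = {a. [a] \<in> Y 1}"
  have sub: "w \<in> lists L \<and> length w = n" if w: "w \<in> Y n" for w n
  proof -
    have "[a] \<in> Y 1" if a: "a \<in> set w" for a
    proof -
      obtain us vs where "w = us @ [a] @ vs" using split_list[OF a] by auto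
      then have "sublist [a] w" by (auto simp: sublist_def)
      from word_system_sublist[OF Y w this] show ?thesis by simp
    qed
    then show ?thesis
      using word_system_subset[OF Y, of n] w by (auto simp: L_def words_def)
  qed
  have inj: "inj_on h L" and img: "h ` L = B" using h by (auto simp: bij_betw_def L_def)
  have "inj_on (map h) (lists L)" using inj by (rule inj_on_map_lists)
  then have "inj_on (map h) (Y n)" by (rule inj_on_subset) (use sub in auto)
  then show "card (map h ` Y n) = card (Y n)" by (rule card_image)
  show "word_system B (\<lambda>n. map h ` Y n)"
  proof (rule word_systemI)
    show "map h ` Y n \<subseteq> words B n" for n
      using sub img by (fastforce simp: words_def)
    show "map h ` Y 0 = {[]}" using word_system_0[OF Y] by simp
    fix n w y assume "w \<in> map h ` Y n" "sublist y w"
    then obtain v where v: "v \<in> Y n" "sublist y (map h v)" by auto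
    then obtain u where "y = map h u" "sublist u v"
      by (auto simp: sublist_def map_eq_append_conv append_eq_map_conv)
    then show "y \<in> map h ` Y (length y)" using word_system_sublist[OF Y v(1)] by auto
  qed
qed

text \<open>Finiteness is recorded separately because \<open>card\<close> is 0 on infinite sets,
  while a bijection between letter sets is later obtained from equal cardinality of finite
  sets.\<close>

lemma card_letters:
  assumes "word_system A Y"
  shows "card {a. [a] \<in> Y 1} = card (Y 1)" and "finite {a. [a] \<in> Y 1} \<longleftrightarrow> finite (Y 1)"
proof -
  have "Y 1 = (\<lambda>a. [a]) ` {a. [a] \<in> Y 1}"
    using word_system_subset[OF assms, of 1] by (auto simp: words_def length_Suc_conv image_iff)
  moreover have "inj_on (\<lambda>a. [a]) {a. [a] \<in> Y 1}" by (simp add: inj_on_def)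
  ultimately show "card {a. [a] \<in> Y 1} = card (Y 1)" "finite {a. [a] \<in> Y 1} \<longleftrightarrow> finite (Y 1)"
    by (metis card_image, metis finite_image_iff)
qed

theorem theorem5p1:
  fixes d :: "nat \<Rightarrow> nat"
  assumes "\<forall>k\<ge>1. \<exists>(A :: 'a set) Y. word_system A Y \<and>
             (\<forall>i\<in>{1..k}. finite (Y i) \<and> card (Y i) = d i)"
  shows "\<exists>(A :: 'a set) X. word_system A X \<and>
             (\<forall>i\<ge>1. finite (X i) \<and> card (X i) = d i)"
proof -
  \<comment> \<open>The common alphabet must lie in the type \<open>'a\<close>; the letters
    occurring in any one of the given systems provide \<open>d 1\<close> suitable elements.\<close>
  obtain A\<^sub>1 :: "'a set" and Y\<^sub>1 where Y1: "word_system A\<^sub>1 Y\<^sub>1" "finite (Y\<^sub>1 1)" "card (Y\<^sub>1 1) = d 1"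
    using assms[rule_format, of 1] by auto
  define B where "B = {a. [a] \<in> Y\<^sub>1 1}"
  have B: "finite B" "card B = d 1"
    using card_letters[OF Y1(1)] Y1 by (simp_all add: B_def)
  \<comment> \<open>The shift to \<open>Suc k\<close> keeps length 1 under control even for
    \<open>k = 0\<close>, so that the letters can always be renamed into \<open>B\<close>.\<close>
  have "\<exists>Z. word_system B Z \<and> (\<forall>i\<in>{1..Suc k}. card (Z i) = d i)" for k
  proof -
    obtain A :: "'a set" and Y where Y: "word_system A Y"
      "\<forall>i\<in>{1..Suc k}. finite (Y i) \<and> card (Y i) = d i"
      using assms[rule_format, of "Suc k"] by auto
    then have "finite (Y 1)" "card (Y 1) = d 1" by auto
    then have "finite {a. [a] \<in> Y 1}" "card {a. [a] \<in> Y 1} = card B"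
      using card_letters[OF Y(1)] B by simp_all
    then obtain h where "bij_betw h {a. [a] \<in> Y 1} B"
      using B(1) finite_same_card_bij by blast
    from word_system_rename[OF Y(1) this] Y(2) show ?thesis by metis
  qed
  then obtain Z where Z: "\<And>k. word_system B (Z k)"
    and card_Z: "\<And>k i. i \<in> {1..Suc k} \<Longrightarrow> card (Z k i) = d i" by metis
  have "finite (range (\<lambda>k. Z k i))" for i
    by (rule finite_subset[of _ "Pow (words B i)"])
      (use word_system_subset[OF Z] finite_words[OF B(1)] in auto)
  from infinitely_many_agree_with_limit[of Z, OF this] obtain X
    where X: "\<And>n. infinite {k. \<forall>i<n. Z k i = X i}" by blast
  \<comment> \<open>An infinite set of indices is unbounded, so an index agreeing with
    \<open>X\<close> up to length \<open>n\<close> can be taken at least \<open>n\<close>, where the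
    cardinality of \<open>Z k n\<close> is prescribed if \<open>n\<close> is positive.\<close>
  have approx: "\<exists>k\<ge>n. \<forall>i\<le>n. Z k i = X i" for n
    using X[of "Suc n"] unfolding finite_nat_set_iff_bounded_le
    by (simp add: less_Suc_eq_le not_le) (meson less_imp_le)
  have sub: "X n \<subseteq> words B n" for n
    using approx[of n] word_system_subset[OF Z] by blast
  have "word_system B X"
  proof (rule word_systemI)
    show "X n \<subseteq> words B n" for n by (rule sub)
    show "X 0 = {[]}" using approx[of 0] word_system_0[OF Z] by auto
    fix n w y assume w: "w \<in> X n" "sublist y w"
    \<comment> \<open>A single \<open>Z k\<close> agrees with \<open>X\<close> at the lengths of
      both \<open>w\<close> and its subword \<open>y\<close>, so closure carries over.\<close>
    obtain k where k: "\<forall>i\<le>n. Z k i = X i" using approx by blast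
    have "length w = n" using sub w(1) by (auto simp: words_def)
    then have "length y \<le> n" using sublist_length_le[OF w(2)] by simp
    then show "y \<in> X (length y)" using word_system_sublist[OF Z _ w(2), of k n] k w(1) by simp
  qed
  moreover have "finite (X i) \<and> card (X i) = d i" if "i \<ge> 1" for i
  proof
    show "finite (X i)" using sub finite_words[OF B(1)] by (rule finite_subset)
    obtain k where "k \<ge> i" "Z k i = X i" using approx[of i] by blast
    then show "card (X i) = d i" using card_Z[of i k] that by simp
  qed
  ultimately show ?thesis by blast
qed

end
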